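(* Let $(X,\tau,\mathscr M,m)$ be a topological measure space and let $AC(X)$ be the collection of all $\mathbb K$-valued absolutely continuous functions on $X$, where $\mathbb K$ is $\mathbb R$ or $\mathbb C$. Then $(AC(X),+,\cdot)$, with pointwise addition and scalar multiplication, forms a vector space over $\mathbb K$. If $AC^b(X)$ denotes the collection of all bounded absolutely continuous functions on $X$, then $AC^b(X)$ (with pointwise operations) is a ring and an algebra over $\mathbb K$.
   Context: Let $(X,\tau)$ be a topological space and $(X,\mathscr M,m)$ a measure space. $(X,\tau,\mathscr M,m)$ is called a topological measure space (tms) if: (i) $\mathscr M$ contains all open sets of $(X,\tau)$; (ii) for every $x\in X$ and every $\varepsilon>0$ there exists an open connected neighbourhood $U$ of $x$ with $m(U)<\varepsilon$; (iii) for every $G\in\tau$ and every $x\in G$ there exists $\varepsilon>0$ such that every open connected neighbourhood $U$ of $x$ with $m(U)<\varepsilon$ satisfies $U\subseteq G$. For $\delta>0$, $\mathcal P_\delta$ denotes the collection of all countable (finite or infinite) families $\{E_i\}_i$ of pairwise disjoint open connected subsets of $X$ with $\sum_i m(E_i)<\delta$. A function $f:X\to\mathbb K$ is absolutely continuous if for every $\varepsilon>0$ there exists $\delta>0$ such that for every $\{D_i\}_i\in\mathcal P_\delta$ one has $\sum_i\omega(f,D_i)<\varepsilon$, where $\omega(f,D):=\sup\{|f(x)-f(y)|:x,y\in D\}$. *)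

theory Defs
  imports
    "HOL-Analysis.Analysis"
    "HOL-Algebra.Module"
    "HOL-Algebra.Algebraic_Closure_Type"
begin

locale topological_measure_space =
  fixes T :: "'a topology" and M :: "'a measure"
  assumes space_eq: "space M = topspace T"
    and open_measurable: "\<And>U. openin T U \<Longrightarrow> U \<in> sets M"
    and small_connected_nbhd:
      "\<And>x (\<epsilon>::real). x \<in> topspace T \<Longrightarrow> \<epsilon> > 0 \<Longrightarrow>
        \<exists>U. openin T U \<and> connectedin T U \<and> x \<in> U \<and> emeasure M U < ennreal \<epsilon>"
    and small_connected_nbhd_subset:
      "\<And>G x. openin T G \<Longrightarrow> x \<in> G \<Longrightarrow>
        \<exists>\<epsilon>::real. \<epsilon> > 0 \<and>
          (\<forall>U. openin T U \<and> connectedin T U \<and> x \<in> U \<and> emeasure M U < ennreal \<epsilon> \<longrightarrow> U \<subseteq> G)"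

text \<open>The countable families in \<open>\<P>\<^sub>\<delta>\<close> are pairs \<open>(I, E)\<close> of an arbitrary (finite or infinite)
  index set \<open>I\<close> of natural numbers and sets \<open>E i\<close>, of which only those with \<open>i \<in> I\<close> matter. The
  sums are taken in \<open>[0, \<infinity>]\<close>, where they always exist.\<close>

definition small_families ::
    "'a topology \<Rightarrow> 'a measure \<Rightarrow> real \<Rightarrow> (nat set \<times> (nat \<Rightarrow> 'a set)) set" where
  "small_families T M \<delta> =
    {(I, E). (\<forall>i\<in>I. openin T (E i) \<and> connectedin T (E i)) \<and> disjoint_family_on E I \<and>
      (\<Sum>\<^sub>\<infinity>i\<in>I. emeasure M (E i)) < ennreal \<delta>}"

text \<open>The supremum is taken in \<open>[0, \<infinity>]\<close>: it is \<open>\<infinity>\<close> if \<open>f\<close> is unbounded on \<open>D\<close>, and \<open>0\<close> if \<open>D\<close> is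
  empty.\<close>

definition oscillation :: "('a \<Rightarrow> 'k::real_normed_vector) \<Rightarrow> 'a set \<Rightarrow> ennreal" where
  "oscillation f D = (SUP (x, y)\<in>D \<times> D. ennreal (norm (f x - f y)))"

definition absolutely_continuous_fun ::
    "'a topology \<Rightarrow> 'a measure \<Rightarrow> ('a \<Rightarrow> 'k::real_normed_vector) \<Rightarrow> bool" where
  "absolutely_continuous_fun T M f \<longleftrightarrow>
    (\<forall>\<epsilon>::real. \<epsilon> > 0 \<longrightarrow> (\<exists>\<delta>::real. \<delta> > 0 \<and>
      (\<forall>(I, D)\<in>small_families T M \<delta>. (\<Sum>\<^sub>\<infinity>i\<in>I. oscillation f (D i)) < ennreal \<epsilon>)))"

text \<open>Functions on \<open>X = topspace T\<close> are represented by extensional functions (fixed to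
  \<open>undefined\<close> outside \<open>X\<close>), so that equality of functions is equality on \<open>X\<close>.\<close>

definition AC :: "'a topology \<Rightarrow> 'a measure \<Rightarrow> ('a \<Rightarrow> 'k::real_normed_vector) set" where
  "AC T M = {f \<in> extensional (topspace T). absolutely_continuous_fun T M f}"

definition AC_bounded :: "'a topology \<Rightarrow> 'a measure \<Rightarrow> ('a \<Rightarrow> 'k::real_normed_vector) set" where
  "AC_bounded T M = {f \<in> AC T M. bounded (f ` topspace T)}"

text \<open>A set \<open>F\<close> of functions on \<open>S\<close> with the pointwise operations. As a module it only involves
  the additive structure and \<open>smult\<close>; the fields \<open>mult\<close> and \<open>one\<close> are then irrelevant.\<close>

definition pointwise :: "'a set \<Rightarrow> ('a \<Rightarrow> 'k::field) set \<Rightarrow> ('k, 'a \<Rightarrow> 'k) module" where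
  "pointwise S F =
    \<lparr>carrier = F,
     monoid.mult = (\<lambda>f g. \<lambda>x\<in>S. f x * g x),
     one = (\<lambda>x\<in>S. 1),
     ring.zero = (\<lambda>x\<in>S. 0),
     add = (\<lambda>f g. \<lambda>x\<in>S. f x + g x),
     module.smult = (\<lambda>c f. \<lambda>x\<in>S. c * f x)\<rparr>"

definition is_vector_space_over :: "('k, 'm) ring_scheme \<Rightarrow> ('k, 'v, 'n) module_scheme \<Rightarrow> bool" where
  "is_vector_space_over K V \<longleftrightarrow> Ring.field K \<and> Module.module K V"

end

theory Submission
  imports Defs
begin

text \<open>
  The analytic content is one transfer principle. Suppose that \<open>h\<close> is controlled by two absolutely
  continuous functions \<open>f\<close> and \<open>g\<close>, in the sense that
  \<open>\<bar>h x - h y\<bar> \<le> C (\<bar>f x - f y\<bar> + \<bar>g x - g y\<bar>)\<close> on \<open>X\<close>. Taking suprema,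
  \<open>\<omega>(h, D) \<le> C (\<omega>(f, D) + \<omega>(g, D))\<close> for every \<open>D \<subseteq> X\<close>, and summing over a family in \<open>\<P>\<^sub>\<delta>\<close> shows that
  \<open>h\<close> is absolutely continuous: given \<open>\<epsilon>\<close>, use for \<open>f\<close> and for \<open>g\<close> the \<open>\<delta>\<close> that belongs to
  \<open>\<epsilon> / (2 C)\<close>, and take the smaller one (\<open>absolutely_continuous_fun_dominated\<close>).

  Sums satisfy this with \<open>C = 1\<close>, multiples \<open>c f\<close> with any \<open>C > \<bar>c\<bar>\<close>, and if \<open>\<bar>f\<bar>, \<bar>g\<bar> \<le> B\<close>, then products
  satisfy it with \<open>C = B\<close>, by \<open>f x g x - f y g y = (f x - f y) g x + f y (g x - g y)\<close>.
  Boundedness enters exactly here, and this is why the ring consists of bounded functions.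
  Constants have oscillation zero. So \<open>AC(X)\<close> is closed under the linear operations and
  \<open>AC\<^sup>b(X)\<close> also under multiplication; the algebraic laws hold because they hold pointwise.
  The argument is the same over \<open>\<real>\<close> and \<open>\<complex>\<close> and is carried out over any normed field.
\<close>

section \<open>Oscillation and unconditional sums\<close>

text \<open>Multiplication is not jointly continuous on \<open>[0, \<infinity>]\<close> (at \<open>0 \<cdot> \<infinity>\<close>), so the general law for
  topological semirings is not applicable; multiplication by a fixed finite constant is continuous.\<close>

lemma infsum_cmult_ennreal:
  fixes f :: "'i \<Rightarrow> ennreal"
  shows "(\<Sum>\<^sub>\<infinity>i\<in>I. ennreal c * f i) = ennreal c * (\<Sum>\<^sub>\<infinity>i\<in>I. f i)"
proof (rule infsumI)
  have "(sum f \<longlongrightarrow> (\<Sum>\<^sub>\<infinity>i\<in>I. f i)) (finite_subsets_at_top I)"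
    using has_sum_infsum[OF nonneg_summable_on_complete, of I f] by (simp add: has_sum_def)
  then have "((\<lambda>F. ennreal c * sum f F) \<longlongrightarrow> ennreal c * (\<Sum>\<^sub>\<infinity>i\<in>I. f i)) (finite_subsets_at_top I)"
    by (intro ennreal_tendsto_cmult) simp_all
  then show "((\<lambda>i. ennreal c * f i) has_sum ennreal c * (\<Sum>\<^sub>\<infinity>i\<in>I. f i)) I"
    by (simp add: has_sum_def sum_distrib_left)
qed

lemma norm_diff_le_oscillation:
  assumes "x \<in> D" "y \<in> D"
  shows "ennreal (norm (f x - f y)) \<le> oscillation f D"
  unfolding oscillation_def using assms by (intro SUP_upper2[of "(x, y)"]) auto

lemma oscillation_dominated:
  assumes "C \<ge> 0"
    and dom: "\<And>x y. x \<in> D \<Longrightarrow> y \<in> D \<Longrightarrow>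
      norm (h x - h y) \<le> C * (norm (f x - f y) + norm (g x - g y))"
  shows "oscillation h D \<le> ennreal C * (oscillation f D + oscillation g D)"
proof -
  have "ennreal (norm (h x - h y)) \<le> ennreal C * (oscillation f D + oscillation g D)"
    if "x \<in> D" "y \<in> D" for x y
  proof -
    have "ennreal (norm (h x - h y)) \<le> ennreal (C * (norm (f x - f y) + norm (g x - g y)))"
      by (rule ennreal_leI[OF dom[OF that]])
    also have "\<dots> = ennreal C * (ennreal (norm (f x - f y)) + ennreal (norm (g x - g y)))"
      using assms(1) by (simp add: ennreal_mult ennreal_plus)
    also have "\<dots> \<le> ennreal C * (oscillation f D + oscillation g D)"
      by (intro mult_left_mono add_mono norm_diff_le_oscillation that) simp
    finally show ?thesis .
  qed
  then show ?thesis
    unfolding oscillation_def[of h] by (intro SUP_least) auto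
qed

section \<open>Absolute continuity by domination\<close>

lemma small_families_mono:
  assumes "\<delta> \<le> \<delta>'"
  shows "small_families T M \<delta> \<subseteq> small_families T M \<delta>'"
  using ennreal_leI[OF assms] unfolding small_families_def by (auto intro: less_le_trans)

lemma small_families_subset_topspace:
  assumes "(I, D) \<in> small_families T M \<delta>" "i \<in> I"
  shows "D i \<subseteq> topspace T"
  using assms openin_subset unfolding small_families_def by fastforce

text \<open>This is the only place where the \<open>\<epsilon>\<close>-\<open>\<delta>\<close> definition is worked with for nonconstant functions.
  Two dominating functions are needed for sums and products; a single one is the case \<open>g = f\<close>.\<close>

lemma absolutely_continuous_fun_dominated:
  assumes f: "absolutely_continuous_fun T M f" and g: "absolutely_continuous_fun T M g"
    and "C > 0"
    and dom: "\<And>x y. x \<in> topspace T \<Longrightarrow> y \<in> topspace T \<Longrightarrow>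
      norm (h x - h y) \<le> C * (norm (f x - f y) + norm (g x - g y))"
  shows "absolutely_continuous_fun T M h"
  unfolding absolutely_continuous_fun_def
proof (intro allI impI)
  fix \<epsilon> :: real
  assume "\<epsilon> > 0"
  define \<eta> where "\<eta> = \<epsilon> / (2 * C)"
  have "\<eta> > 0"
    using \<open>\<epsilon> > 0\<close> \<open>C > 0\<close> by (simp add: \<eta>_def)
  obtain \<delta>f where \<delta>f: "\<delta>f > 0"
    "\<And>I D. (I, D) \<in> small_families T M \<delta>f \<Longrightarrow> (\<Sum>\<^sub>\<infinity>i\<in>I. oscillation f (D i)) < ennreal \<eta>"
    using f \<open>\<eta> > 0\<close> unfolding absolutely_continuous_fun_def by fast
  obtain \<delta>g where \<delta>g: "\<delta>g > 0"
    "\<And>I D. (I, D) \<in> small_families T M \<delta>g \<Longrightarrow> (\<Sum>\<^sub>\<infinity>i\<in>I. oscillation g (D i)) < ennreal \<eta>"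
    using g \<open>\<eta> > 0\<close> unfolding absolutely_continuous_fun_def by fast
  have "(\<Sum>\<^sub>\<infinity>i\<in>I. oscillation h (D i)) < ennreal \<epsilon>"
    if ID: "(I, D) \<in> small_families T M (min \<delta>f \<delta>g)" for I D
  proof -
    have sums: "(\<Sum>\<^sub>\<infinity>i\<in>I. oscillation f (D i)) < ennreal \<eta>" "(\<Sum>\<^sub>\<infinity>i\<in>I. oscillation g (D i)) < ennreal \<eta>"
      using subsetD[OF small_families_mono ID] by (auto intro!: \<delta>f(2) \<delta>g(2))
    have "(\<Sum>\<^sub>\<infinity>i\<in>I. oscillation h (D i))
        \<le> (\<Sum>\<^sub>\<infinity>i\<in>I. ennreal C * (oscillation f (D i) + oscillation g (D i)))"
      using small_families_subset_topspace[OF ID] \<open>C > 0\<close>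
      by (intro infsum_mono nonneg_summable_on_complete oscillation_dominated dom) auto
    also have "\<dots> = ennreal C * ((\<Sum>\<^sub>\<infinity>i\<in>I. oscillation f (D i)) + (\<Sum>\<^sub>\<infinity>i\<in>I. oscillation g (D i)))"
      by (simp add: infsum_cmult_ennreal infsum_add nonneg_summable_on_complete)
    also have "\<dots> < ennreal C * (ennreal \<eta> + ennreal \<eta>)"
      using \<open>C > 0\<close> sums by (intro ennreal_mult_strict_left_mono add_strict_mono) auto
    also have "\<dots> = ennreal \<epsilon>"
      using \<open>C > 0\<close> \<open>\<epsilon> > 0\<close> \<open>\<eta> > 0\<close>
      by (simp add: \<eta>_def flip: ennreal_plus ennreal_mult)
    finally show ?thesis .
  qed
  then show "\<exists>\<delta>>0. \<forall>(I, D)\<in>small_families T M \<delta>. (\<Sum>\<^sub>\<infinity>i\<in>I. oscillation h (D i)) < ennreal \<epsilon>"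
    using \<delta>f(1) \<delta>g(1) by (intro exI[of _ "min \<delta>f \<delta>g"]) auto
qed

lemma absolutely_continuous_fun_constant:
  assumes const: "\<And>x y. x \<in> topspace T \<Longrightarrow> y \<in> topspace T \<Longrightarrow> h x = h y"
  shows "absolutely_continuous_fun T M h"
proof -
  have "(\<Sum>\<^sub>\<infinity>i\<in>I. oscillation h (D i)) = 0" if ID: "(I, D) \<in> small_families T M 1" for I D
  proof (rule infsum_0)
    fix i
    assume "i \<in> I"
    then have Di: "D i \<subseteq> topspace T"
      by (rule small_families_subset_topspace[OF ID])
    have "oscillation h (D i) \<le> 0"
      unfolding oscillation_def
    proof (rule SUP_least, clarify)
      fix x y
      assume "x \<in> D i" "y \<in> D i"
      then have "h x = h y"
        using Di by (intro const) auto
      then show "ennreal (norm (h x - h y)) \<le> 0"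
        by simp
    qed
    then show "oscillation h (D i) = 0"
      by simp
  qed
  then show ?thesis
    unfolding absolutely_continuous_fun_def by (auto intro!: exI[of _ "1::real"])
qed

section \<open>Closure under the pointwise operations\<close>

lemma const_in_AC: "(\<lambda>x\<in>topspace T. c) \<in> AC T M"
  by (simp add: AC_def absolutely_continuous_fun_constant)

lemma add_in_AC:
  assumes "f \<in> AC T M" "g \<in> AC T M"
  shows "(\<lambda>x\<in>topspace T. f x + g x) \<in> AC T M"
proof -
  have "absolutely_continuous_fun T M (\<lambda>x\<in>topspace T. f x + g x)"
    using assms by - (rule absolutely_continuous_fun_dominated[of T M f g 1],
      auto simp: AC_def norm_diff_triangle_ineq)
  then show ?thesis
    by (simp add: AC_def)
qed

lemma smult_in_AC:
  fixes c :: "'k::real_normed_field"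
  assumes "f \<in> AC T M"
  shows "(\<lambda>x\<in>topspace T. c * f x) \<in> AC T M"
proof -
  \<comment> \<open>The constant \<open>\<bar>c\<bar> + 1\<close> is positive even for \<open>c = 0\<close>.\<close>
  have "norm (c * f x - c * f y) \<le> (norm c + 1) * (norm (f x - f y) + norm (f x - f y))" for x y
    unfolding right_diff_distrib[symmetric] norm_mult by (intro mult_mono) auto
  then have "absolutely_continuous_fun T M (\<lambda>x\<in>topspace T. c * f x)"
    using assms by - (rule absolutely_continuous_fun_dominated[of T M f f "norm c + 1"],
      auto simp: AC_def add_nonneg_pos)
  then show ?thesis
    by (simp add: AC_def)
qed

lemma const_in_AC_bounded: "(\<lambda>x\<in>topspace T. c) \<in> AC_bounded T M"
  by (auto simp: AC_bounded_def const_in_AC bounded_iff)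

lemma add_in_AC_bounded:
  assumes "f \<in> AC_bounded T M" "g \<in> AC_bounded T M"
  shows "(\<lambda>x\<in>topspace T. f x + g x) \<in> AC_bounded T M"
  using assms bounded_plus_comp[of f "topspace T" g]
  by (simp add: AC_bounded_def add_in_AC)

text \<open>The increments of \<open>f\<close> and \<open>g\<close> appear in the increment of \<open>f g\<close> multiplied by values of the other
  factor, and a common bound for these values is the constant of the domination.\<close>

lemma mult_in_AC_bounded:
  fixes f g :: "'a \<Rightarrow> 'k::real_normed_field"
  assumes f: "f \<in> AC_bounded T M" and g: "g \<in> AC_bounded T M"
  shows "(\<lambda>x\<in>topspace T. f x * g x) \<in> AC_bounded T M"
proof -
  obtain B where "B > 0" and B: "\<And>x. x \<in> topspace T \<Longrightarrow> norm (f x) \<le> B \<and> norm (g x) \<le> B"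
  proof -
    have "bounded (f ` topspace T \<union> g ` topspace T)"
      using f g by (simp add: AC_bounded_def)
    then show thesis
      using that unfolding bounded_pos by blast
  qed
  have "norm (f x * g x - f y * g y) \<le> B * (norm (f x - f y) + norm (g x - g y))"
    if "x \<in> topspace T" "y \<in> topspace T" for x y
  proof -
    have "f x * g x - f y * g y = (f x - f y) * g x + f y * (g x - g y)"
      by (simp add: algebra_simps)
    then have "norm (f x * g x - f y * g y) \<le> norm (f x - f y) * norm (g x) + norm (f y) * norm (g x - g y)"
      by (metis norm_mult norm_triangle_ineq)
    also have "\<dots> \<le> norm (f x - f y) * B + B * norm (g x - g y)"
      using B that by (intro add_mono mult_left_mono mult_right_mono) auto
    finally show ?thesis
      by (simp add: algebra_simps)
  qed
  then have "absolutely_continuous_fun T M (\<lambda>x\<in>topspace T. f x * g x)"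
    using f g \<open>B > 0\<close> by - (rule absolutely_continuous_fun_dominated[of T M f g B],
      auto simp: AC_bounded_def AC_def)
  moreover have "norm (f x * g x) \<le> B * B" if "x \<in> topspace T" for x
    unfolding norm_mult using B[OF that] \<open>B > 0\<close> by (intro mult_mono) auto
  then have "bounded ((\<lambda>x\<in>topspace T. f x * g x) ` topspace T)"
    by (auto simp: bounded_iff)
  ultimately show ?thesis
    by (simp add: AC_bounded_def AC_def)
qed

text \<open>Multiplication by a scalar is multiplication by a bounded constant function.\<close>

lemma smult_in_AC_bounded:
  fixes c :: "'k::real_normed_field"
  assumes "f \<in> AC_bounded T M"
  shows "(\<lambda>x\<in>topspace T. c * f x) \<in> AC_bounded T M"
proof -
  have "(\<lambda>x\<in>topspace T. (\<lambda>x\<in>topspace T. c) x * f x) = (\<lambda>x\<in>topspace T. c * f x)"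
    by (rule restrict_ext) simp
  then show ?thesis
    using mult_in_AC_bounded[OF const_in_AC_bounded assms, of c] by simp
qed

section \<open>Modules and algebras of functions\<close>

text \<open>Inside the function space every law is inherited pointwise from the field. Extensionality is
  what makes \<open>\<zero>\<close> and \<open>\<one>\<close> neutral: restricting \<open>f\<close> to \<open>S\<close> must give back \<open>f\<close> itself. Closure under
  negation is the case \<open>c = -1\<close> of closure under multiples.\<close>

lemma module_pointwise:
  fixes F :: "('a \<Rightarrow> 'k::field) set"
  assumes ext: "F \<subseteq> extensional S"
    and zero: "(\<lambda>x\<in>S. 0) \<in> F"
    and add: "\<And>f g. f \<in> F \<Longrightarrow> g \<in> F \<Longrightarrow> (\<lambda>x\<in>S. f x + g x) \<in> F"
    and smult: "\<And>c f. f \<in> F \<Longrightarrow> (\<lambda>x\<in>S. c * f x) \<in> F"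
  shows "Module.module ring_of_type_algebra (pointwise S F)"
proof (rule moduleI)
  show "cring (ring_of_type_algebra :: 'k ring)"
    by (rule cring_from_type_algebra)
  have restrict_F: "restrict f S = f" if "f \<in> F" for f
    using ext that by (auto intro: extensional_restrict)
  show "abelian_group (pointwise S F)"
  proof (rule abelian_groupI)
    fix f
    assume f: "f \<in> carrier (pointwise S F)"
    show "\<zero>\<^bsub>pointwise S F\<^esub> \<oplus>\<^bsub>pointwise S F\<^esub> f = f"
      using f restrict_F by (simp add: pointwise_def cong: restrict_cong)
    show "\<exists>g\<in>carrier (pointwise S F). g \<oplus>\<^bsub>pointwise S F\<^esub> f = \<zero>\<^bsub>pointwise S F\<^esub>"
      using f smult[of f "-1"]
      by (intro bexI[of _ "\<lambda>x\<in>S. - 1 * f x"]) (auto simp: pointwise_def intro!: restrict_ext)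
  qed (auto simp: pointwise_def zero add algebra_simps intro!: restrict_ext)
  show "\<one>\<^bsub>ring_of_type_algebra\<^esub> \<odot>\<^bsub>pointwise S F\<^esub> f = f" if "f \<in> carrier (pointwise S F)" for f
    using that restrict_F by (simp add: pointwise_def ring_of_type_algebra_def)
qed (auto simp: pointwise_def ring_of_type_algebra_def smult algebra_simps intro!: restrict_ext)

lemma algebra_pointwise:
  fixes F :: "('a \<Rightarrow> 'k::field) set"
  assumes ext: "F \<subseteq> extensional S"
    and zero: "(\<lambda>x\<in>S. 0) \<in> F"
    and one: "(\<lambda>x\<in>S. 1) \<in> F"
    and add: "\<And>f g. f \<in> F \<Longrightarrow> g \<in> F \<Longrightarrow> (\<lambda>x\<in>S. f x + g x) \<in> F"
    and mult: "\<And>f g. f \<in> F \<Longrightarrow> g \<in> F \<Longrightarrow> (\<lambda>x\<in>S. f x * g x) \<in> F"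
    and smult: "\<And>c f. f \<in> F \<Longrightarrow> (\<lambda>x\<in>S. c * f x) \<in> F"
  shows "Module.algebra ring_of_type_algebra (pointwise S F)"
proof -
  interpret module ring_of_type_algebra "pointwise S F"
    by (rule module_pointwise[OF ext zero add smult])
  have restrict_F: "restrict f S = f" if "f \<in> F" for f
    using ext that by (auto intro: extensional_restrict)
  have "comm_monoid (pointwise S F)"
  proof (rule comm_monoidI)
    show "\<one>\<^bsub>pointwise S F\<^esub> \<otimes>\<^bsub>pointwise S F\<^esub> f = f" if "f \<in> carrier (pointwise S F)" for f
      using that restrict_F by (simp add: pointwise_def cong: restrict_cong)
  qed (auto simp: pointwise_def one mult algebra_simps intro!: restrict_ext)
  then have "cring (pointwise S F)"
    by (intro cringI M.abelian_group_axioms)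
      (auto simp: pointwise_def algebra_simps intro!: restrict_ext)
  then show ?thesis
    by (intro algebra.intro module_axioms algebra_axioms.intro)
      (auto simp: pointwise_def algebra_simps intro!: restrict_ext)
qed

lemma vector_space_AC:
  "is_vector_space_over (ring_of_type_algebra :: 'k::real_normed_field ring)
     (pointwise (topspace T) (AC T M :: ('a \<Rightarrow> 'k) set))"
  unfolding is_vector_space_over_def
proof
  show "Ring.field (ring_of_type_algebra :: 'k ring)"
    by (rule field_from_type_algebra)
  show "Module.module ring_of_type_algebra (pointwise (topspace T) (AC T M :: ('a \<Rightarrow> 'k) set))"
    by (intro module_pointwise const_in_AC add_in_AC smult_in_AC) (auto simp: AC_def)
qed

lemma algebra_AC_bounded:
  "Module.algebra (ring_of_type_algebra :: 'k::real_normed_field ring)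
     (pointwise (topspace T) (AC_bounded T M :: ('a \<Rightarrow> 'k) set))"
  by (intro algebra_pointwise const_in_AC_bounded add_in_AC_bounded mult_in_AC_bounded
      smult_in_AC_bounded) (auto simp: AC_bounded_def AC_def)

theorem corollary4p9:
  fixes T :: "'a topology" and M :: "'a measure"
  assumes "topological_measure_space T M"
  shows
    "is_vector_space_over (ring_of_type_algebra :: real ring)
       (pointwise (topspace T) (AC T M :: ('a \<Rightarrow> real) set)) \<and>
     Ring.ring (pointwise (topspace T) (AC_bounded T M :: ('a \<Rightarrow> real) set)) \<and>
     Module.algebra (ring_of_type_algebra :: real ring)
       (pointwise (topspace T) (AC_bounded T M :: ('a \<Rightarrow> real) set)) \<and>
     is_vector_space_over (ring_of_type_algebra :: complex ring)
       (pointwise (topspace T) (AC T M :: ('a \<Rightarrow> complex) set)) \<and>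
     Ring.ring (pointwise (topspace T) (AC_bounded T M :: ('a \<Rightarrow> complex) set)) \<and>
     Module.algebra (ring_of_type_algebra :: complex ring)
       (pointwise (topspace T) (AC_bounded T M :: ('a \<Rightarrow> complex) set))"
  by (intro conjI vector_space_AC algebra_AC_bounded
      cring.axioms(1)[OF algebra.M_cring[OF algebra_AC_bounded]])

end
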